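(* Let $\sigma\in(0,\infty)$ and $t\in\mathbb{R}$. Among positive Borel measures on $i\mathbb{R}$ that are absolutely continuous with respect to Lebesgue measure $m_{i\mathbb{R}}$, there is exactly one, $\mathfrak{p}_{\sigma+it}$, that represents the point $\sigma+it$ for $A_\tau(\overline{\mathbb{H}})$, i.e. satisfies $$\mathfrak{f}(\sigma+it)=\int_{i\mathbb{R}}\mathfrak{f}\,d\mathfrak{p}_{\sigma+it}\qquad\text{for all }\mathfrak{f}\in A_\tau(\overline{\mathbb{H}}),$$ and it is the measure whose density at the point $is\in i\mathbb{R}$ ($s\in\mathbb{R}$), with respect to Lebesgue measure $ds$, is $$\frac{\sigma}{\pi\left(\sigma^2+(s-t)^2\right)}.$$
   Context: $p_k$ is the $k$-th prime. $\mathbb{Z}^\infty$ is the group of finitely supported integer sequences $\mathbf{n}=(n_1,n_2,\dots)$, $\tau(\mathbf{n})=\sum_k n_k\log p_k$. It is the dual of the compact group $\mathbb{T}^\omega$ (product of countably many circles), via the characters $\gamma_{\mathbf{n}}(\boldsymbol{\lambda})=\prod_k\lambda_k^{n_k}$; Fourier transforms are taken with respect to normalized Haar measure. $A_\tau(\mathbb{T}^\omega)$ is the algebra of all $f\in C(\mathbb{T}^\omega)$ with $\hat f(\mathbf{n})=0$ whenever $\tau(\mathbf{n})<0$, with the uniform norm. For $\sigma\in[0,\infty)$ let $\mathbf{p}^{-\sigma}=(p_k^{-\sigma})_{k\ge1}$. The Poisson measure $P_{\mathbf{r}}$, $\mathbf{r}=\mathbf{p}^{-\sigma}$, is the unique positive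 Borel measure on $\mathbb{T}^\omega$ with $\hat P_{\mathbf{r}}(\mathbf{n})=e^{-\sigma|\tau(\mathbf{n})|}$ for all $\mathbf{n}\in\mathbb{Z}^\infty$. For $f\in C(\mathbb{T}^\omega)$, $f_{\mathbf{r}}(\boldsymbol{\lambda})=\int_{\mathbb{T}^\omega}f(\boldsymbol{\lambda}\boldsymbol{\beta}^{-1})\,dP_{\mathbf{r}}(\boldsymbol{\beta})$. $\overline{\mathbb{H}}=\{\sigma+it:\sigma\ge0,\ t\in\mathbb{R}\}\cup\{\boldsymbol{\infty}\}$. For $f\in A_\tau(\mathbb{T}^\omega)$ define $\mathfrak{f}$ on $\overline{\mathbb{H}}$ by $\mathfrak{f}(\sigma+it)=f_{\mathbf{p}^{-\sigma}}(\mathbf{p}^{-it})$, where $\mathbf{p}^{-it}=(p_k^{-it})_{k\ge1}\in\mathbb{T}^\omega$, and $\mathfrak{f}(\boldsymbol{\infty})=\hat f(\mathbf{0})$. (Thus $f=\gamma_{\mathbf{n}}$ with $\tau(\mathbf{n})\ge0$ gives $\mathfrak{f}(z)=e^{-z\tau(\mathbf{n})}$ for $z\neq\boldsymbol{\infty}$.) $A_\tau(\overline{\mathbb{H}})$ is the set of all such $\mathfrak{f}$, $f\in A_\tau(\mathbb{T}^\omega)$. *)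

theory Defs
  imports
    "HOL-Probability.Probability"
    "HOL-Computational_Algebra.Primes"
    "HOL-Library.Poly_Mapping"
begin

text \<open>Sequences are indexed from 0, so \<open>nth_prime 0 = 2\<close>. The group of finitely supported
  integer sequences is the type \<open>nat \<Rightarrow>\<^sub>0 int\<close>.\<close>

definition nth_prime :: "nat \<Rightarrow> nat" where
  "nth_prime k = enumerate {p. prime p} k"

definition tau :: "(nat \<Rightarrow>\<^sub>0 int) \<Rightarrow> real" where
  "tau n = (\<Sum>k\<in>Poly_Mapping.keys n. of_int (Poly_Mapping.lookup n k) * ln (real (nth_prime k)))"

text \<open>The infinite torus carries the topology induced by the product topology on
  \<^typ>\<open>nat \<Rightarrow> complex\<close>. Functions on it are functions on \<^typ>\<open>nat \<Rightarrow> complex\<close> whose values off the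
  torus are irrelevant; this is why all measures below have the torus itself as their space.\<close>

definition torus :: "(nat \<Rightarrow> complex) set" where
  "torus = {l. \<forall>k. norm (l k) = 1}"

definition torus_borel :: "(nat \<Rightarrow> complex) measure" where
  "torus_borel = restrict_space borel torus"

definition character :: "(nat \<Rightarrow>\<^sub>0 int) \<Rightarrow> (nat \<Rightarrow> complex) \<Rightarrow> complex" where
  "character n l = (\<Prod>k\<in>Poly_Mapping.keys n. l k powi Poly_Mapping.lookup n k)"

text \<open>Normalized Haar measure on the torus is the product of the normalized arc length measures,
  here as the image of the product of uniform distributions of the angles.\<close>

definition haar :: "(nat \<Rightarrow> complex) measure" where
  "haar = distr (\<Pi>\<^sub>M k\<in>UNIV. uniform_measure lborel {0..2 * pi}) torus_borel (\<lambda>x k. cis (x k))"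

definition fourier :: "((nat \<Rightarrow> complex) \<Rightarrow> complex) \<Rightarrow> (nat \<Rightarrow>\<^sub>0 int) \<Rightarrow> complex" where
  "fourier f n = (\<integral>l. f l * cnj (character n l) \<partial>haar)"

definition fourier_measure :: "(nat \<Rightarrow> complex) measure \<Rightarrow> (nat \<Rightarrow>\<^sub>0 int) \<Rightarrow> complex" where
  "fourier_measure P n = (\<integral>l. cnj (character n l) \<partial>P)"

definition A_tau_torus :: "((nat \<Rightarrow> complex) \<Rightarrow> complex) set" where
  "A_tau_torus = {f. continuous_on torus f \<and> (\<forall>n. tau n < 0 \<longrightarrow> fourier f n = 0)}"

text \<open>\<open>poisson \<sigma>\<close> is the Poisson measure with parameter sequence \<open>(p\<^sub>k powr - \<sigma>)\<close>, for \<open>\<sigma> \<ge> 0\<close>.\<close>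

definition poisson :: "real \<Rightarrow> (nat \<Rightarrow> complex) measure" where
  "poisson \<sigma> = (THE P. sets P = sets torus_borel \<and> finite_measure P \<and>
     (\<forall>n. fourier_measure P n = of_real (exp (- \<sigma> * \<bar>tau n\<bar>))))"

definition poisson_conv ::
    "((nat \<Rightarrow> complex) \<Rightarrow> complex) \<Rightarrow> real \<Rightarrow> (nat \<Rightarrow> complex) \<Rightarrow> complex" where
  "poisson_conv f \<sigma> l = (\<integral>b. f (\<lambda>k. l k * inverse (b k)) \<partial>poisson \<sigma>)"

definition prime_flow :: "real \<Rightarrow> nat \<Rightarrow> complex" where
  "prime_flow t k = of_nat (nth_prime k) powr (- \<i> * of_real t)"

text \<open>The closed right half-plane with a point at infinity, which is represented by \<^const>\<open>None\<close>.\<close>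

definition Hbar :: "complex option set" where
  "Hbar = insert None (Some ` {z. Re z \<ge> 0})"

definition half_plane_fun :: "((nat \<Rightarrow> complex) \<Rightarrow> complex) \<Rightarrow> complex option \<Rightarrow> complex" where
  "half_plane_fun f =
     (\<lambda>w\<in>Hbar. case w of None \<Rightarrow> fourier f 0 | Some z \<Rightarrow> poisson_conv f (Re z) (prime_flow (Im z)))"

definition A_tau_Hbar :: "(complex option \<Rightarrow> complex) set" where
  "A_tau_Hbar = half_plane_fun ` A_tau_torus"

definition imag_axis :: "complex set" where
  "imag_axis = {z. Re z = 0}"

definition imag_borel :: "complex measure" where
  "imag_borel = restrict_space borel imag_axis"

definition imag_lebesgue :: "complex measure" where
  "imag_lebesgue = distr lborel imag_borel (\<lambda>s. \<i> * of_real s)"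

definition represents :: "complex measure \<Rightarrow> complex option \<Rightarrow> bool" where
  "represents \<mu> w \<longleftrightarrow>
     (\<forall>F\<in>A_tau_Hbar. integrable \<mu> (\<lambda>z. F (Some z)) \<and> F w = (\<integral>z. F (Some z) \<partial>\<mu>))"

definition ac_representing_measure :: "complex option \<Rightarrow> complex measure \<Rightarrow> bool" where
  "ac_representing_measure w \<mu> \<longleftrightarrow>
     sets \<mu> = sets imag_borel \<and> absolutely_continuous imag_lebesgue \<mu> \<and> represents \<mu> w"

end

theory Submission
  imports Defs "HOL-Complex_Analysis.Complex_Analysis" "HOL-Real_Asymp.Real_Asymp"
begin

text \<open>Both halves rest on the homomorphism \<^const>\<open>prime_flow\<close> from the real line to the torus, on
  which \<open>character n (prime_flow s)\<close> is \<open>cis (- s * tau n)\<close>.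

  Existence. The Cauchy distribution with scale \<open>\<sigma>\<close> and centre 0 has characteristic function
  \<open>exp (- \<sigma> * \<bar>x\<bar>)\<close>, so its image under the flow has Fourier coefficients
  \<open>exp (- \<sigma> * \<bar>tau n\<bar>)\<close>. Finite Borel measures on the torus are determined by their Fourier
  coefficients, hence this image is the Poisson measure (\<open>poisson_eq_flow_of_cauchy\<close>). For every
  continuous \<open>f\<close>, convolving with the Poisson measure at the point \<open>prime_flow t\<close> is therefore
  integrating \<open>f\<close> along the flow against the Cauchy density centred at \<open>t\<close>
  (\<open>poisson_conv_prime_flow\<close>). Since \<open>poisson 0\<close> is the point mass at the identity, the values of \<open>f\<close>
  along the flow are the boundary values on the imaginary axis, and this is the representation to be
  proved.

  Uniqueness. The characters with \<open>tau n \<ge> 0\<close> belong to the algebra, by orthogonality of characters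
  under Haar measure. A representing measure, read as a measure on the real line, thus has prescribed
  characteristic function at the points \<open>tau n\<close>, up to complex conjugation. These points include all
  logarithms of positive rationals and are dense; characteristic functions are continuous, so the
  whole characteristic function is prescribed, and Levy's uniqueness theorem applies
  (\<open>representing_measure_unique\<close>).\<close>

section \<open>Finite Borel measures and continuous functions\<close>

text \<open>Closed sets generate the Borel sets and are stable under intersection, and the indicator of a
  closed set is the pointwise limit of the continuous functions \<open>max 0 (1 - n * infdist x C)\<close>.\<close>

lemma finite_borel_measure_eqI:
  fixes M N :: "'a::metric_space measure"
  assumes "finite_measure M" "finite_measure N"
    and sets: "sets M = sets borel" "sets N = sets borel"
    and eq: "\<And>f :: 'a \<Rightarrow> real. continuous_on UNIV f \<Longrightarrow> (\<And>x. 0 \<le> f x \<and> f x \<le> 1) \<Longrightarrow>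
      integral\<^sup>L M f = integral\<^sup>L N f"
  shows "M = N"
proof (rule measure_eqI_generator_eq)
  interpret M: finite_measure M by fact
  interpret N: finite_measure N by fact
  note [measurable_cong] = sets
  show "Int_stable (Collect closed :: 'a set set)"
    by (auto simp: Int_stable_def)
  show "Collect closed \<subseteq> Pow (UNIV :: 'a set)" by simp
  show "sets M = sigma_sets UNIV (Collect closed)" "sets N = sigma_sets UNIV (Collect closed)"
    using sets by (auto simp: borel_eq_closed)
  show "range (\<lambda>_. UNIV) \<subseteq> Collect (closed :: 'a set \<Rightarrow> bool)" "(\<Union>i. UNIV) = (UNIV :: 'a set)"
    "emeasure M UNIV \<noteq> \<infinity>" by (auto simp: M.emeasure_eq_measure)
  fix C :: "'a set" assume "C \<in> Collect closed"
  then have C: "closed C" by simp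
  show "emeasure M C = emeasure N C"
  proof (cases "C = {}")
    case False
    define f where "f n x = max 0 (1 - real n * infdist x C)" for n x
    have cont: "continuous_on UNIV (f n)" for n
      unfolding f_def by (intro continuous_intros)
    have rng: "0 \<le> f n x \<and> f n x \<le> 1" for n x
      unfolding f_def by (simp add: infdist_nonneg)
    have meas: "f n \<in> borel_measurable borel" for n
      using cont by (rule borel_measurable_continuous_onI)
    have lim: "(\<lambda>n. f n x) \<longlonglongrightarrow> indicator C x" for x
    proof (cases "x \<in> C")
      case True
      then have "f n x = indicator C x" for n by (simp add: f_def)
      then show ?thesis by simp
    next
      case notin: False
      then have pos: "infdist x C > 0"
        using C False by (simp add: infdist_pos_not_in_closed)
      obtain n0 :: nat where n0: "1 / infdist x C < real n0"
        using reals_Archimedean2 by blast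
      have "f n x = 0" if "n \<ge> n0" for n
      proof -
        have "1 < real n0 * infdist x C"
          using n0 pos by (simp add: field_simps)
        also have "\<dots> \<le> real n * infdist x C"
          using that pos by (intro mult_right_mono) auto
        finally show ?thesis by (simp add: f_def)
      qed
      then have "eventually (\<lambda>n. f n x = indicator C x) sequentially"
        using notin by (auto simp: eventually_sequentially)
      then show ?thesis by (rule tendsto_eventually)
    qed
    have conv: "(\<lambda>n. integral\<^sup>L K (f n)) \<longlonglongrightarrow> measure K C"
      if K: "finite_measure K" "sets K = sets borel" for K :: "'a measure"
    proof -
      interpret K: finite_measure K by fact
      note [measurable_cong] = K(2)
      have "(\<lambda>n. integral\<^sup>L K (f n)) \<longlonglongrightarrow> integral\<^sup>L K (indicator C)"
      proof (rule integral_dominated_convergence)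
        show "AE x in K. norm (f n x) \<le> 1" for n using rng[of n] by auto
        show "(indicator C :: 'a \<Rightarrow> real) \<in> borel_measurable K"
          using C by (simp add: borel_closed K(2) borel_measurable_indicator)
        show "f n \<in> borel_measurable K" for n
          using meas[of n] by simp
      qed (use lim in auto)
      then show ?thesis using C K(2) sets_eq_imp_space_eq[OF K(2)] by simp
    qed
    have "measure M C = measure N C"
      using conv[OF assms(1) sets(1)] conv[OF assms(2) sets(2)] eq[OF cont rng]
      by (auto intro: LIMSEQ_unique)
    then show ?thesis by (simp add: M.emeasure_eq_measure N.emeasure_eq_measure)
  qed simp
qed

section \<open>The Fourier transform of the Cauchy density\<close>

lemma integrable_inverse_1_plus_square_lborel:
  "integrable lborel (\<lambda>x::real. 1 / (1 + x\<^sup>2))"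
  using integrable_inverse_1_plus_square
  by (simp add: set_integrable_def einterval_def divide_inverse)

lemma integral_inverse_1_plus_square_lborel:
  "(\<integral>x. 1 / (1 + x\<^sup>2) \<partial>lborel) = pi"
  using LBINT_inverse_1_plus_square
  by (simp add: interval_lebesgue_integral_def set_lebesgue_integral_def einterval_def divide_inverse)

text \<open>Subtracting \<open>exp (- x)\<close>, the value of \<open>exp (\<i> * x * z)\<close> at \<open>\<i>\<close>, makes the singularity at \<open>\<i>\<close>
  removable. Contour integrals in the upper half-plane then vanish, which yields the integral of the
  exponential from that of \<open>1 / (1 + s\<^sup>2)\<close>.\<close>

lemma upper_half_plane_quotient_holomorphic:
  fixes x :: real
  shows "\<exists>h. h holomorphic_on {z. Im z > -1} \<and>
    (\<forall>z. z \<noteq> \<i> \<longrightarrow> h z = (exp (\<i> * x * z) - exp (- x)) / (1 + z\<^sup>2))"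
proof -
  define g where "g = (\<lambda>z. exp (\<i> * of_real x * z))"
  define k where "k = (\<lambda>z. (g z - g \<i>) / (z - \<i>))"
  have "(g has_field_derivative deriv g \<i>) (at \<i>)"
    by (rule holomorphic_derivI[where S = UNIV]) (auto simp: g_def intro!: holomorphic_intros)
  then have lim: "k \<midarrow>\<i>\<rightarrow> deriv g \<i>"
    by (simp add: k_def has_field_derivative_iff)
  have "k holomorphic_on UNIV - {\<i>}"
    unfolding k_def g_def by (intro holomorphic_intros) auto
  then have holo: "(\<lambda>z. if z = \<i> then deriv g \<i> else k z) holomorphic_on UNIV"
    using lim by (intro removable_singularity) auto
  define h where "h = (\<lambda>z. (if z = \<i> then deriv g \<i> else k z) / (z + \<i>))"
  have "h holomorphic_on {z. Im z > -1}"
    unfolding h_def by (intro holomorphic_intros holomorphic_on_subset[OF holo])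
      (auto simp: complex_eq_iff)
  moreover have "h z = (exp (\<i> * x * z) - exp (- x)) / (1 + z\<^sup>2)" if "z \<noteq> \<i>" for z
  proof -
    have "1 + z\<^sup>2 = (z - \<i>) * (z + \<i>)"
      by (simp add: power2_eq_square algebra_simps)
    moreover have "\<i> * of_real x * \<i> = - of_real x" by (simp add: complex_eq_iff)
    then have "g \<i> = exp (- of_real x)" by (simp add: g_def)
    ultimately show ?thesis using that by (simp add: h_def k_def g_def flip: exp_of_real)
  qed
  ultimately show ?thesis by blast
qed

text \<open>Cauchy's theorem on the boundary of the upper half disc replaces the integral over the diameter
  by one over the arc. For \<open>x \<ge> 0\<close> the exponential is at most 1 in modulus there, so the numerator is
  at most 2 and the denominator at least \<open>r\<^sup>2 - 1\<close>.\<close>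

lemma half_disc_integral_bound:
  fixes x r :: real
  assumes "x \<ge> 0" "r > 1"
  shows "norm (integral {-r..r} (\<lambda>s. (exp (\<i> * x * of_real s) - exp (- x)) / (1 + (of_real s)\<^sup>2)))
     \<le> 2 / (r\<^sup>2 - 1) * r * pi"
proof -
  obtain h where h: "h holomorphic_on {z. Im z > -1}"
    and heq: "\<And>z. z \<noteq> \<i> \<Longrightarrow> h z = (exp (\<i> * x * z) - exp (- x)) / (1 + z\<^sup>2)"
    using upper_half_plane_quotient_holomorphic by blast
  define L where "L = linepath (- of_real r) (of_real r :: complex)"
  define C where "C = part_circlepath 0 r 0 pi"
  have r: "r > 0" using assms by simp
  have imC: "Im z \<ge> 0 \<and> norm z = r" if "z \<in> path_image C" for z
  proof -
    from that r obtain s where s: "0 \<le> s" "s \<le> pi" "z = r * exp (\<i> * of_real s)"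
      by (auto simp: C_def path_image_part_circlepath)
    then show ?thesis using r by (auto simp: Im_exp norm_mult sin_ge_zero)
  qed
  have imL: "Im z = 0" if "z \<in> path_image L" for z
    using that by (auto simp: L_def closed_segment_def)
  have cauchy: "(h has_contour_integral 0) (L +++ C)"
  proof (rule Cauchy_theorem_convex_simple[OF h])
    show "convex {z. Im z > -1}" by (rule convex_halfspace_Im_gt)
    show "valid_path (L +++ C)" by (simp add: L_def C_def)
    show "path_image (L +++ C) \<subseteq> {z. Im z > -1}"
      using imL imC by (force simp: L_def C_def path_image_join)
  qed (simp_all add: L_def C_def)
  have cont: "continuous_on {z. Im z > -1} h"
    using h by (rule holomorphic_on_imp_continuous_on)
  have hL: "h contour_integrable_on L"
    unfolding L_def using imL
    by (intro contour_integrable_continuous_linepath continuous_on_subset[OF cont]) (force simp: L_def)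
  have hC: "h contour_integrable_on C"
    unfolding C_def using imC
    by (intro contour_integrable_continuous_part_circlepath continuous_on_subset[OF cont]) (force simp: C_def)
  have "contour_integral L h + contour_integral C h = 0"
    using contour_integral_join[OF hL hC] contour_integral_unique[OF cauchy]
    by (simp add: L_def C_def)
  then have "norm (contour_integral L h) = norm (contour_integral C h)"
    by (simp add: eq_neg_iff_add_eq_0[symmetric])
  also have "\<dots> \<le> 2 / (r\<^sup>2 - 1) * r * \<bar>pi - 0\<bar>"
    unfolding C_def
  proof (rule contour_integral_bound_part_circlepath)
    show "h contour_integrable_on part_circlepath 0 r 0 pi" using hC by (simp add: C_def)
    have "1 < r\<^sup>2" using assms by simp
    then show "0 \<le> 2 / (r\<^sup>2 - 1)" by simp
    show "norm (h z) \<le> 2 / (r\<^sup>2 - 1)" if "z \<in> path_image (part_circlepath 0 r 0 pi)" for z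
    proof -
      have z: "Im z \<ge> 0" "norm z = r" using imC that by (auto simp: C_def)
      then have "z \<noteq> \<i>" using assms by auto
      have "norm (exp (\<i> * x * z) - of_real (exp (- x))) \<le> norm (exp (\<i> * x * z)) + norm (of_real (exp (- x)) :: complex)"
        by (rule norm_triangle_ineq4)
      also have "\<dots> \<le> 1 + 1" using z assms by (intro add_mono) auto
      finally have 1: "norm (exp (\<i> * x * z) - of_real (exp (- x))) \<le> 2" by simp
      have "r\<^sup>2 - 1 = norm (z\<^sup>2) - norm (1::complex)" using z by (simp add: norm_power)
      also have "\<dots> \<le> norm (z\<^sup>2 + 1)" using norm_diff_ineq[of "z\<^sup>2" 1] by simp
      finally have 2: "r\<^sup>2 - 1 \<le> norm (1 + z\<^sup>2)" by (simp add: add.commute)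
      show ?thesis using 1 2 \<open>1 < r\<^sup>2\<close> unfolding heq[OF \<open>z \<noteq> \<i>\<close>] norm_divide
        by (intro frac_le) auto
    qed
  qed (use r in auto)
  also have "contour_integral L h = integral {-r..r} (\<lambda>s. h (of_real s))"
    unfolding L_def using r by (subst contour_integral_linepath_Reals_eq) auto
  also have "\<dots> = integral {-r..r} (\<lambda>s. (exp (\<i> * x * of_real s) - exp (- x)) / (1 + (of_real s)\<^sup>2))"
    by (intro integral_cong heq) (auto simp: complex_eq_iff)
  finally show ?thesis by simp
qed

lemma norm_one_plus_square_of_real: "norm (1 + (complex_of_real s)\<^sup>2) = 1 + s\<^sup>2"
proof -
  have "1 + (complex_of_real s)\<^sup>2 = of_real (1 + s\<^sup>2)" by simp
  then show ?thesis by (simp only: norm_of_real) simp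
qed

text \<open>The bound on half discs tends to 0 as the radius grows, so \<open>iexp (x * s)\<close> may be replaced under
  the integral by the constant \<open>exp (- x)\<close> when \<open>x \<ge> 0\<close>. The substitution \<open>s \<mapsto> - s\<close> gives
  the other sign of \<open>x\<close>.\<close>

lemma integral_iexp_over_1_plus_square:
  "(\<integral>s. iexp (x * s) / (1 + s\<^sup>2) \<partial>lborel) = pi * exp (- \<bar>x\<bar>)"
proof -
  have integrable: "integrable lborel (\<lambda>s. iexp (y * s) / (1 + s\<^sup>2))" for y :: real
    by (rule Bochner_Integration.integrable_bound[OF integrable_inverse_1_plus_square_lborel])
       (auto simp: norm_divide norm_one_plus_square_of_real)
  have pos: "(\<integral>s. iexp (y * s) / (1 + s\<^sup>2) \<partial>lborel) = pi * exp (- y)" if "y \<ge> 0" for y :: real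
  proof -
    define u where "u s = (iexp (y * s) - exp (- y)) / (1 + s\<^sup>2)" for s :: real
    have c: "(\<lambda>s. complex_of_real (exp (- y)) / complex_of_real (1 + s\<^sup>2)) =
        (\<lambda>s. of_real (exp (- y)) * complex_of_real (1 / (1 + s\<^sup>2)))"
      by auto
    have int2: "integrable lborel (\<lambda>s. complex_of_real (exp (- y)) / complex_of_real (1 + s\<^sup>2))"
      unfolding c
      by (intro Bochner_Integration.integrable_mult_right integrable_of_real integrable_inverse_1_plus_square_lborel)
    have val2: "(\<integral>s. complex_of_real (exp (- y)) / complex_of_real (1 + s\<^sup>2) \<partial>lborel) =
        of_real (exp (- y)) * complex_of_real pi"
      unfolding c by (simp only: integral_mult_right_zero integral_complex_of_real
          integral_inverse_1_plus_square_lborel)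
    have intu: "integrable lborel u"
      unfolding u_def[abs_def] diff_divide_distrib by (intro Bochner_Integration.integrable_diff integrable int2)
    have split: "integral\<^sup>L lborel u = (\<integral>s. iexp (y * s) / (1 + s\<^sup>2) \<partial>lborel) - complex_of_real (exp (- y)) * complex_of_real pi"
      unfolding u_def[abs_def] diff_divide_distrib
      by (subst Bochner_Integration.integral_diff[OF integrable int2]) (simp only: val2)
    have "((\<lambda>n. integral\<^sup>L lborel (\<lambda>s. indicator {- real n..real n} s *\<^sub>R u s))) \<longlonglongrightarrow> integral\<^sup>L lborel u"
    proof (rule integral_dominated_convergence)
      show "integrable lborel (\<lambda>s. norm (u s))" using intu by (rule integrable_norm)
      show "AE s in lborel. (\<lambda>n. indicator {- real n..real n} s *\<^sub>R u s) \<longlonglongrightarrow> u s"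
      proof (intro AE_I2 tendsto_eventually)
        fix s :: real
        obtain N :: nat where "\<bar>s\<bar> < N" using reals_Archimedean2 by blast
        then show "eventually (\<lambda>n. indicator {- real n..real n} s *\<^sub>R u s = u s) sequentially"
          unfolding eventually_sequentially by (intro exI[of _ N]) (auto simp: indicator_def)
      qed
    qed (use intu in \<open>auto simp: indicator_def\<close>)
    moreover have "(\<lambda>n. integral\<^sup>L lborel (\<lambda>s. indicator {- real n..real n} s *\<^sub>R u s)) \<longlonglongrightarrow> 0"
    proof (rule Lim_null_comparison)
      show "eventually (\<lambda>n. norm (integral\<^sup>L lborel (\<lambda>s. indicator {- real n..real n} s *\<^sub>R u s))
          \<le> 2 / ((real n)\<^sup>2 - 1) * real n * pi) sequentially"
        using eventually_gt_at_top[of 1]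
      proof eventually_elim
        case (elim n)
        have "set_integrable lborel {- real n..real n} u"
          unfolding set_integrable_def using intu by (intro integrable_mult_indicator) auto
        from set_borel_integral_eq_integral(2)[OF this]
        have "integral\<^sup>L lborel (\<lambda>s. indicator {- real n..real n} s *\<^sub>R u s) = integral {- real n..real n} u"
          by (simp add: set_lebesgue_integral_def)
        then show ?case using half_disc_integral_bound[OF that, of "real n"] elim
          by (simp add: u_def[abs_def] mult.assoc)
      qed
      show "(\<lambda>n. 2 / ((real n)\<^sup>2 - 1) * real n * pi) \<longlonglongrightarrow> 0" by real_asymp
    qed
    ultimately have "integral\<^sup>L lborel u = 0" by (rule LIMSEQ_unique)
    then show ?thesis using split by (simp add: mult.commute exp_of_real)
  qed
  show ?thesis
  proof (cases "x \<ge> 0")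
    case True
    then show ?thesis using pos[of x] by simp
  next
    case False
    have "(\<integral>s. iexp (x * s) / (1 + s\<^sup>2) \<partial>lborel) = (\<integral>s. iexp (- x * s) / (1 + s\<^sup>2) \<partial>lborel)"
      by (subst lborel_integral_real_affine[of "-1" _ 0]) auto
    also have "\<dots> = pi * exp (- \<bar>x\<bar>)" using pos[of "- x"] False by simp
    finally show ?thesis .
  qed
qed

section \<open>Characters of the infinite torus\<close>

text \<open>The defining sum and product run over the support of \<open>n\<close>. Allowing any larger finite index set
  lets \<open>m\<close>, \<open>n\<close> and \<open>m + n\<close> be treated over a common one.\<close>

lemma tau_superset:
  assumes "finite K" "Poly_Mapping.keys n \<subseteq> K"
  shows "tau n = (\<Sum>k\<in>K. of_int (Poly_Mapping.lookup n k) * ln (real (nth_prime k)))"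
  unfolding tau_def using assms
  by (intro sum.mono_neutral_left) (auto simp: in_keys_iff)

lemma character_superset:
  assumes "finite K" "Poly_Mapping.keys n \<subseteq> K"
  shows "character n l = (\<Prod>k\<in>K. l k powi Poly_Mapping.lookup n k)"
  unfolding character_def using assms
  by (intro prod.mono_neutral_left) (auto simp: in_keys_iff)

lemma tau_zero [simp]: "tau 0 = 0"
  by (simp add: tau_def)

lemma character_zero [simp]: "character 0 l = 1"
  by (simp add: character_def)

lemma tau_add: "tau (m + n) = tau m + tau n"
proof -
  define K where "K = Poly_Mapping.keys m \<union> Poly_Mapping.keys n"
  have K: "finite K" "Poly_Mapping.keys m \<subseteq> K" "Poly_Mapping.keys n \<subseteq> K"
      "Poly_Mapping.keys (m + n) \<subseteq> K"
    using Poly_Mapping.keys_add[of m n] by (auto simp: K_def)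
  show ?thesis
    by (simp add: tau_superset[OF K(1,2)] tau_superset[OF K(1,3)] tau_superset[OF K(1,4)]
        lookup_add algebra_simps sum.distrib)
qed

lemma tau_uminus: "tau (- n) = - tau n"
  using tau_add[of n "- n"] by simp

lemma torus_nonzero: "l \<in> torus \<Longrightarrow> l k \<noteq> 0"
  by (metis (mono_tags, lifting) torus_def mem_Collect_eq norm_zero zero_neq_one)

lemma character_add:
  assumes "l \<in> torus"
  shows "character (m + n) l = character m l * character n l"
proof -
  define K where "K = Poly_Mapping.keys m \<union> Poly_Mapping.keys n"
  have K: "finite K" "Poly_Mapping.keys m \<subseteq> K" "Poly_Mapping.keys n \<subseteq> K"
      "Poly_Mapping.keys (m + n) \<subseteq> K"
    using Poly_Mapping.keys_add[of m n] by (auto simp: K_def)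
  show ?thesis
    by (simp add: character_superset[OF K(1,2)] character_superset[OF K(1,3)]
        character_superset[OF K(1,4)] lookup_add power_int_add torus_nonzero[OF assms] prod.distrib)
qed

lemma norm_character: "l \<in> torus \<Longrightarrow> norm (character n l) = 1"
  by (simp add: character_def torus_def norm_power_int flip: prod_norm)

lemma character_uminus:
  assumes "l \<in> torus"
  shows "character (- n) l = cnj (character n l)"
proof -
  have "character (- n) l * character n l = 1"
    using character_add[OF assms, of "- n" n] by simp
  moreover have "cnj (character n l) * character n l = 1"
    using complex_norm_square[of "character n l"] norm_character[OF assms, of n] by (simp add: mult.commute)
  moreover have "character n l \<noteq> 0" using norm_character[OF assms, of n] by auto
  ultimately show ?thesis by (metis mult_right_cancel)
qed

lemma torus_mult: "l \<in> torus \<Longrightarrow> l' \<in> torus \<Longrightarrow> (\<lambda>k. l k * l' k) \<in> torus"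
  by (simp add: torus_def norm_mult)

lemma torus_inverse: "l \<in> torus \<Longrightarrow> (\<lambda>k. inverse (l k)) \<in> torus"
  by (simp add: torus_def norm_inverse)

lemma continuous_on_character: "continuous_on torus (character n)"
  unfolding character_def
  by (intro continuous_intros continuous_on_subset[OF continuous_on_product_coordinates])
     (auto simp: torus_nonzero)

lemma torus_eq_PiE: "torus = PiE UNIV (\<lambda>_. sphere 0 1)"
  by (auto simp: torus_def PiE_def)

lemma compact_torus: "compact torus"
proof -
  have "compactin (product_topology (\<lambda>_. euclidean) UNIV) torus"
    unfolding torus_eq_PiE compactin_PiE by simp
  then show ?thesis by (simp add: euclidean_product_topology)
qed

lemma space_torus_borel [simp]: "space torus_borel = torus"
  by (simp add: torus_borel_def space_restrict_space)

lemma borel_measurable_torus_borel: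
  "continuous_on torus f \<Longrightarrow> f \<in> borel_measurable torus_borel"
  unfolding torus_borel_def by (rule borel_measurable_continuous_on_restrict)

lemma measurable_torus_borelI:
  assumes "f \<in> borel_measurable M" "\<And>x. x \<in> space M \<Longrightarrow> f x \<in> torus"
  shows "f \<in> measurable M torus_borel"
  unfolding torus_borel_def using assms by (intro measurable_restrict_space2) auto

lemma bounded_continuous_torus:
  fixes f :: "(nat \<Rightarrow> complex) \<Rightarrow> 'b::real_normed_vector"
  assumes "continuous_on torus f"
  obtains B where "\<And>l. l \<in> torus \<Longrightarrow> norm (f l) \<le> B"
proof -
  have "bounded (f ` torus)"
    using compact_continuous_image[OF assms compact_torus] by (rule compact_imp_bounded)
  then show ?thesis using that by (auto simp: bounded_iff)
qed

lemma integrable_continuous_torus: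
  fixes f :: "(nat \<Rightarrow> complex) \<Rightarrow> 'b::{banach, second_countable_topology}"
  assumes "finite_measure P" "sets P = sets torus_borel" "continuous_on torus f"
  shows "integrable P f"
proof -
  interpret finite_measure P by fact
  obtain B where B: "\<And>l. l \<in> torus \<Longrightarrow> norm (f l) \<le> B"
    using bounded_continuous_torus[OF assms(3)] by blast
  have "space P = torus" using sets_eq_imp_space_eq[OF assms(2)] by simp
  moreover have "f \<in> borel_measurable P"
    using borel_measurable_torus_borel[OF assms(3)] measurable_cong_sets[OF assms(2) refl] by blast
  ultimately show ?thesis using B by (intro integrable_const_bound[of _ B]) auto
qed

section \<open>Fourier coefficients determine a measure on the torus\<close>

text \<open>Frequencies may be repeated in the list, so that addition is concatenation.\<close>

definition trig_poly :: "((nat \<Rightarrow>\<^sub>0 int) \<times> complex) list \<Rightarrow> (nat \<Rightarrow> complex) \<Rightarrow> complex" where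
  "trig_poly cs l = (\<Sum>(n, c)\<leftarrow>cs. c * character n l)"

lemma trig_poly_simps [simp]:
  "trig_poly [] l = 0"
  "trig_poly ((n, c) # cs) l = c * character n l + trig_poly cs l"
  "trig_poly (cs @ ds) l = trig_poly cs l + trig_poly ds l"
  by (simp_all add: trig_poly_def)

lemma continuous_on_trig_poly: "continuous_on torus (trig_poly cs)"
proof (induction cs)
  case Nil
  then show ?case by (simp add: trig_poly_def)
next
  case (Cons a cs)
  then show ?case by (cases a) (auto intro!: continuous_intros continuous_on_character simp: fun_eq_iff cong: continuous_on_cong)
qed

lemma trig_poly_mult: "\<exists>es. \<forall>l\<in>torus. trig_poly es l = trig_poly cs l * trig_poly ds l"
proof (induction cs)
  case Nil
  show ?case by (intro exI[of _ "[]"]) simp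
next
  case (Cons a cs)
  obtain n c where a: "a = (n, c)" by fastforce
  from Cons obtain es where es: "\<forall>l\<in>torus. trig_poly es l = trig_poly cs l * trig_poly ds l" by blast
  have "\<forall>l\<in>torus. trig_poly (map (\<lambda>(m, d). (n + m, c * d)) ds) l = c * character n l * trig_poly ds l"
    by (induction ds) (auto simp: character_add algebra_simps)
  then have "\<forall>l\<in>torus. trig_poly (map (\<lambda>(m, d). (n + m, c * d)) ds @ es) l = trig_poly (a # cs) l * trig_poly ds l"
    using es by (simp add: a algebra_simps)
  then show ?case by blast
qed

text \<open>The real-valued trigonometric polynomials form an algebra of functions on the compact torus. It
  separates points because it contains the real and imaginary parts of the coordinates, so the
  Stone--Weierstrass theorem applies.\<close>

lemma trig_poly_dense:
  fixes f :: "(nat \<Rightarrow> complex) \<Rightarrow> real"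
  assumes "continuous_on torus f" "e > 0"
  shows "\<exists>cs. \<forall>l\<in>torus. norm (of_real (f l) - trig_poly cs l) < e"
proof -
  define R where "R = {g. \<exists>cs. \<forall>l\<in>torus. complex_of_real (g l) = trig_poly cs l}"
  interpret function_ring_on R torus
  proof
    show "compact torus" by (rule compact_torus)
    show "continuous_on torus g" if "g \<in> R" for g
    proof -
      from that obtain cs where cs: "\<forall>l\<in>torus. complex_of_real (g l) = trig_poly cs l"
        by (auto simp: R_def)
      have "g l = Re (trig_poly cs l)" if "l \<in> torus" for l
        using cs that by (metis Re_complex_of_real)
      then show ?thesis
        using continuous_on_Re[OF continuous_on_trig_poly[of cs]] by (simp cong: continuous_on_cong)
    qed
    show "(\<lambda>x. g x + h x) \<in> R" if "g \<in> R" "h \<in> R" for g h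
    proof -
      from that obtain cs ds where "\<forall>l\<in>torus. complex_of_real (g l) = trig_poly cs l"
        "\<forall>l\<in>torus. complex_of_real (h l) = trig_poly ds l" by (auto simp: R_def)
      then show ?thesis unfolding R_def by (intro CollectI exI[of _ "cs @ ds"]) simp
    qed
    show "(\<lambda>x. g x * h x) \<in> R" if "g \<in> R" "h \<in> R" for g h
    proof -
      from that obtain cs ds where "\<forall>l\<in>torus. complex_of_real (g l) = trig_poly cs l"
        "\<forall>l\<in>torus. complex_of_real (h l) = trig_poly ds l" by (auto simp: R_def)
      moreover obtain es where "\<forall>l\<in>torus. trig_poly es l = trig_poly cs l * trig_poly ds l"
        using trig_poly_mult by blast
      ultimately show ?thesis unfolding R_def by (intro CollectI exI[of _ es]) simp
    qed
    show "(\<lambda>_. c) \<in> R" for c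
      unfolding R_def by (intro CollectI exI[of _ "[(0, of_real c)]"]) simp
    show "\<exists>g\<in>R. g x \<noteq> g y" if xy: "x \<in> torus" "y \<in> torus" "x \<noteq> y" for x y
    proof -
      obtain k where k: "x k \<noteq> y k" using xy by auto
      define n where "n = Poly_Mapping.single k (1::int)"
      have ch: "character n l = l k" for l by (simp add: n_def character_def)
      have cn: "character (- n) l = cnj (l k)" if "l \<in> torus" for l
        using character_uminus[OF that, of n] by (simp add: ch)
      have "(\<lambda>l. Re (l k)) \<in> R" unfolding R_def
        by (intro CollectI exI[of _ "[(n, 1/2), (- n, 1/2)]"]) (auto simp: ch cn complex_eq_iff)
      then have re: ?thesis if "Re (x k) \<noteq> Re (y k)"
        using that by (intro bexI[of _ "\<lambda>l. Re (l k)"])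
      have "(\<lambda>l. Im (l k)) \<in> R" unfolding R_def
        by (intro CollectI exI[of _ "[(n, - \<i>/2), (- n, \<i>/2)]"]) (auto simp: ch cn complex_eq_iff)
      then have im: ?thesis if "Im (x k) \<noteq> Im (y k)"
        using that by (intro bexI[of _ "\<lambda>l. Im (l k)"])
      have "Re (x k) \<noteq> Re (y k) \<or> Im (x k) \<noteq> Im (y k)"
        using k by (simp add: complex_eq_iff)
      then show ?thesis using re im by (elim disjE)
    qed
  qed
  obtain g where g: "g \<in> R" "\<forall>l\<in>torus. \<bar>f l - g l\<bar> < e"
    using Stone_Weierstrass_basic[OF assms] by blast
  then obtain cs where cs: "\<forall>l\<in>torus. complex_of_real (g l) = trig_poly cs l" by (auto simp: R_def)
  have "norm (of_real (f l) - trig_poly cs l) < e" if "l \<in> torus" for l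
  proof -
    have "of_real (f l) - trig_poly cs l = complex_of_real (f l - g l)" using cs that by simp
    then show ?thesis using g that by (simp only: norm_of_real)
  qed
  then show ?thesis by blast
qed

lemma fourier_measure_uminus:
  assumes "sets P = sets torus_borel"
  shows "fourier_measure P (- n) = (\<integral>l. character n l \<partial>P)"
proof -
  have "space P = torus" using sets_eq_imp_space_eq[OF assms] by simp
  then show ?thesis unfolding fourier_measure_def
    by (intro Bochner_Integration.integral_cong) (auto simp: character_uminus)
qed

lemma fourier_measure_eq_imp_integral_eq:
  fixes f :: "(nat \<Rightarrow> complex) \<Rightarrow> real"
  assumes P: "finite_measure P" "sets P = sets torus_borel"
    and Q: "finite_measure Q" "sets Q = sets torus_borel"
    and eq: "\<And>n. fourier_measure P n = fourier_measure Q n"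
    and f: "continuous_on torus f"
  shows "integral\<^sup>L P f = integral\<^sup>L Q f"
proof -
  \<comment> \<open>Approximating \<open>f\<close> to within \<open>e / D\<close> costs less than \<open>e\<close> for both integrals together; the summand 1
    keeps \<open>D\<close> positive.\<close>
  define D where "D = measure P torus + measure Q torus + 1"
  have D: "D > 0" by (simp add: D_def add_nonneg_pos)
  have trig: "integral\<^sup>L P (trig_poly cs) = integral\<^sup>L Q (trig_poly cs)" for cs
  proof (induction cs)
    case (Cons a cs)
    obtain n c where a: "a = (n, c)" by fastforce
    have step: "integral\<^sup>L K (trig_poly (a # cs)) =
        c * fourier_measure K (- n) + integral\<^sup>L K (trig_poly cs)"
      if K: "finite_measure K" "sets K = sets torus_borel" for K
      unfolding a trig_poly_simps(2) fourier_measure_uminus[OF K(2)]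
      by (subst Bochner_Integration.integral_add)
         (auto intro!: integrable_continuous_torus[OF K] continuous_intros continuous_on_character continuous_on_trig_poly)
    show ?case by (simp add: step[OF P] step[OF Q] Cons eq)
  qed (simp add: trig_poly_def)
  have close: "norm (of_real (integral\<^sup>L K f) - integral\<^sup>L K (trig_poly cs)) \<le> e * measure K torus"
    if K: "finite_measure K" "sets K = sets torus_borel"
      and cs: "\<forall>l\<in>torus. norm (of_real (f l) - trig_poly cs l) < e" for K cs e
  proof -
    interpret K: finite_measure K by fact
    have sp: "space K = torus" using sets_eq_imp_space_eq[OF K(2)] by simp
    have c1: "continuous_on torus (\<lambda>l. complex_of_real (f l))"
      using f by (intro continuous_intros)
    have "of_real (integral\<^sup>L K f) - integral\<^sup>L K (trig_poly cs) =
        (\<integral>l. of_real (f l) - trig_poly cs l \<partial>K)"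
      by (subst Bochner_Integration.integral_diff)
         (auto intro!: integrable_continuous_torus[OF K] c1 continuous_on_trig_poly)
    also have "norm \<dots> \<le> (\<integral>l. norm (of_real (f l) - trig_poly cs l) \<partial>K)"
      by (rule integral_norm_bound)
    also have "\<dots> \<le> (\<integral>l. e \<partial>K)"
      using cs by (intro integral_mono integrable_continuous_torus[OF K])
        (auto simp: sp intro!: continuous_intros c1 continuous_on_trig_poly less_imp_le)
    finally show ?thesis by (simp add: sp mult.commute)
  qed
  have "\<bar>integral\<^sup>L P f - integral\<^sup>L Q f\<bar> \<le> 0 + e" if "e > 0" for e
  proof -
    have "e / D > 0" using that D by simp
    from trig_poly_dense[OF f this] obtain cs
      where cs: "\<forall>l\<in>torus. norm (of_real (f l) - trig_poly cs l) < e / D" by blast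
    have "\<bar>integral\<^sup>L P f - integral\<^sup>L Q f\<bar> = norm (complex_of_real (integral\<^sup>L P f - integral\<^sup>L Q f))"
      by (simp only: norm_of_real)
    also have "\<dots> = norm ((of_real (integral\<^sup>L P f) - integral\<^sup>L P (trig_poly cs)) -
        (of_real (integral\<^sup>L Q f) - integral\<^sup>L Q (trig_poly cs)))"
      by (simp add: trig)
    also have "\<dots> \<le> e / D * measure P torus + e / D * measure Q torus"
      by (rule order_trans[OF norm_triangle_ineq4 add_mono[OF close[OF P cs] close[OF Q cs]]])
    also have "\<dots> = e / D * (measure P torus + measure Q torus)"
      by (rule distrib_left[symmetric])
    also have "\<dots> = e / D * (D - 1)" by (simp add: D_def)
    also have "\<dots> \<le> e" using that D by (simp add: field_simps)
    finally show ?thesis by simp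
  qed
  then have "\<bar>integral\<^sup>L P f - integral\<^sup>L Q f\<bar> \<le> 0" by (rule field_le_epsilon)
  then show ?thesis by simp
qed

text \<open>The measures have the torus as their space; they are compared as measures on the whole metric
  space \<^typ>\<open>nat \<Rightarrow> complex\<close>, to which they are pushed by the inclusion.\<close>

lemma measure_eq_if_fourier_measure_eq:
  assumes P: "finite_measure P" "sets P = sets torus_borel"
    and Q: "finite_measure Q" "sets Q = sets torus_borel"
    and eq: "\<And>n. fourier_measure P n = fourier_measure Q n"
  shows "P = Q"
proof -
  have incl: "(\<lambda>l. l) \<in> measurable K borel" if "sets K = sets torus_borel" for K
    unfolding measurable_cong_sets[OF that refl] by (intro borel_measurable_torus_borel continuous_on_id)
  have "distr P borel (\<lambda>l. l) = distr Q borel (\<lambda>l. l)"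
  proof (rule finite_borel_measure_eqI)
    show "finite_measure (distr P borel (\<lambda>l. l))" "finite_measure (distr Q borel (\<lambda>l. l))"
      using P Q by (auto intro: finite_measure.finite_measure_distr incl)
    fix f :: "(nat \<Rightarrow> complex) \<Rightarrow> real" assume f: "continuous_on UNIV f"
    then have "f \<in> borel_measurable borel" by (rule borel_measurable_continuous_onI)
    then show "integral\<^sup>L (distr P borel (\<lambda>l. l)) f = integral\<^sup>L (distr Q borel (\<lambda>l. l)) f"
      using fourier_measure_eq_imp_integral_eq[OF P Q eq continuous_on_subset[OF f subset_UNIV]]
      by (simp add: integral_distr[OF incl[OF P(2)]] integral_distr[OF incl[OF Q(2)]])
  qed simp_all
  note distr_eq = this
  show ?thesis
  proof (rule measure_eqI)
    show "sets P = sets Q" using P Q by simp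
    fix A assume "A \<in> sets P"
    then obtain B where B: "B \<in> sets borel" "A = torus \<inter> B"
      using P(2) by (auto simp: torus_borel_def sets_restrict_space)
    have "emeasure K A = emeasure (distr K borel (\<lambda>l. l)) B" if "sets K = sets torus_borel" for K
      using emeasure_distr[OF incl[OF that] B(1)] sets_eq_imp_space_eq[OF that] B(2)
      by (simp add: Int_commute)
    then show "emeasure P A = emeasure Q A" using P Q distr_eq by simp
  qed
qed

text \<open>Uniqueness makes the definite description in the definition of \<^const>\<open>poisson\<close> meaningful, so any
  measure with the right Fourier coefficients is the Poisson measure.\<close>

lemma poisson_eqI:
  assumes "finite_measure P" "sets P = sets torus_borel"
    and "\<And>n. fourier_measure P n = of_real (exp (- \<sigma> * \<bar>tau n\<bar>))"
  shows "poisson \<sigma> = P"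
  unfolding poisson_def using assms
  by (intro the_equality) (auto intro: measure_eq_if_fourier_measure_eq)

section \<open>Orthogonality of characters under Haar measure\<close>

lemma prob_space_uniform_angle: "prob_space (uniform_measure lborel {0..2 * pi})"
  by (rule prob_space_uniform_measure) auto

lemma cis_coordinates_measurable:
  "(\<lambda>x k. cis (x k)) \<in> measurable (\<Pi>\<^sub>M k\<in>UNIV. uniform_measure lborel {0..2 * pi}) torus_borel"
proof (rule measurable_torus_borelI)
  have [measurable]: "cis \<in> borel_measurable borel"
    by (intro borel_measurable_continuous_onI continuous_intros)
  have [measurable_cong]: "sets (uniform_measure lborel {0..2 * pi}) = sets borel" by simp
  show "(\<lambda>x k. cis (x k)) \<in> borel_measurable (\<Pi>\<^sub>M k\<in>(UNIV::nat set). uniform_measure lborel {0..2 * pi})"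
    by (rule measurable_coordinatewise_then_product) measurable
qed (simp add: torus_def)

lemma sets_haar [simp]: "sets haar = sets torus_borel"
  by (simp add: haar_def)

lemma prob_space_haar: "prob_space haar"
  unfolding haar_def
  by (intro prob_space.prob_space_distr prob_space_PiM prob_space_uniform_angle cis_coordinates_measurable)

lemma integral_cis_power_int_uniform:
  assumes "m \<noteq> 0"
  shows "(\<integral>x. cis x powi m \<partial>uniform_measure lborel {0..2 * pi}) = 0"
proof -
  define A where "A = {0..2 * pi}"
  have cis_meas [measurable]: "(\<lambda>x. cis (of_int m * x)) \<in> borel_measurable borel"
    by (intro borel_measurable_continuous_onI continuous_intros)
  have u: "uniform_measure lborel A = density lborel (\<lambda>x. ennreal (indicator A x / (2 * pi)))"
    unfolding uniform_measure_def A_def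
    by (intro density_cong) (auto simp: indicator_def divide_ennreal[symmetric] ennreal_1[symmetric] simp del: ennreal_1)
  have "(\<integral>x. cis x powi m \<partial>uniform_measure lborel A) =
      (\<integral>x. (1 / (2 * pi)) *\<^sub>R (indicator A x *\<^sub>R cis (of_int m * x)) \<partial>lborel)"
    unfolding u cis_power_int by (subst integral_density) (auto simp: A_def)
  also have "\<dots> = (1 / (2 * pi)) *\<^sub>R (\<integral>x. indicator A x *\<^sub>R cis (of_int m * x) \<partial>lborel)"
    by (simp only: integral_scaleR_right)
  also have "(\<integral>x. indicator A x *\<^sub>R cis (of_int m * x) \<partial>lborel) =
      cis (of_int m * (2 * pi)) / (\<i> * of_int m) - cis (of_int m * 0) / (\<i> * of_int m)"
    unfolding A_def
  proof (rule integral_FTC_Icc)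
    show "((\<lambda>x. cis (of_int m * x) / (\<i> * of_int m)) has_vector_derivative cis (of_int m * x))
      (at x within {0..2 * pi})" for x
      unfolding cis_conv_exp using assms
      by (auto intro!: derivative_eq_intros has_vector_derivative_real_field simp: field_simps)
  qed (auto intro!: continuous_intros)
  also have "cis (of_int m * (2 * pi)) = 1"
    using cis_multiple_2pi[of "of_int m"] by (simp add: mult.commute)
  finally show ?thesis by (simp add: A_def)
qed

text \<open>A character depends on finitely many coordinates only, so its integral is a finite product of
  integrals over circles, at least one of which has a nonzero exponent.\<close>

lemma integral_character_haar:
  assumes "n \<noteq> 0"
  shows "(\<integral>l. character n l \<partial>haar) = 0"
proof -
  define U where "U = uniform_measure lborel {0..2 * pi}"
  define J where "J = Poly_Mapping.keys n"
  define m where "m = Poly_Mapping.lookup n"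
  interpret U: prob_space U unfolding U_def by (rule prob_space_uniform_angle)
  interpret product_prob_space "\<lambda>_. U" "UNIV :: nat set" by unfold_locales
  have setsU [measurable_cong]: "sets U = sets borel" by (simp add: U_def)
  have J: "finite J" "J \<noteq> {}" using assms by (auto simp: J_def)
  have cis_meas [measurable]: "(\<lambda>x. cis x powi i) \<in> borel_measurable borel" for i
    unfolding cis_power_int by (intro borel_measurable_continuous_onI continuous_intros)
  have "(\<integral>l. character n l \<partial>haar) = (\<integral>x. character n (\<lambda>k. cis (x k)) \<partial>(\<Pi>\<^sub>M k\<in>UNIV. U))"
    unfolding haar_def U_def
    by (rule integral_distr[OF cis_coordinates_measurable
          borel_measurable_torus_borel[OF continuous_on_character]])
  also have "\<dots> = (\<integral>x. (\<Prod>k\<in>J. cis (restrict x J k) powi m k) \<partial>(\<Pi>\<^sub>M k\<in>UNIV. U))"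
    by (simp add: character_def J_def m_def)
  also have "\<dots> = (\<integral>y. (\<Prod>k\<in>J. cis (y k) powi m k) \<partial>distr (\<Pi>\<^sub>M k\<in>UNIV. U) (\<Pi>\<^sub>M k\<in>J. U) (\<lambda>x. restrict x J))"
    by (rule integral_distr[symmetric]) measurable
  also have "\<dots> = (\<integral>y. (\<Prod>k\<in>J. cis (y k) powi m k) \<partial>(\<Pi>\<^sub>M k\<in>J. U))"
    using J by (simp add: distr_PiM_restrict_finite)
  also have "\<dots> = (\<Prod>k\<in>J. \<integral>y. cis y powi m k \<partial>U)"
    using J(1) by (rule product_integral_prod)
      (auto intro!: U.integrable_const_bound[of _ 1] simp: norm_power_int)
  also have "\<dots> = 0"
  proof (rule prod_zero[OF J(1)])
    obtain k where "k \<in> J" using J(2) by blast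
    then have "(\<integral>y. cis y powi m k \<partial>U) = 0"
      unfolding U_def by (intro integral_cis_power_int_uniform) (simp add: J_def m_def in_keys_iff)
    then show "\<exists>k\<in>J. (\<integral>y. cis y powi m k \<partial>U) = 0" using \<open>k \<in> J\<close> by blast
  qed
  finally show ?thesis .
qed

lemma fourier_character: "fourier (character n) m = (if n = m then 1 else 0)"
proof -
  interpret prob_space haar by (rule prob_space_haar)
  have sp: "space haar = torus" using sets_eq_imp_space_eq[OF sets_haar] by simp
  have diff: "character (n - m) l = character n l * cnj (character m l)" if "l \<in> torus" for l
    using character_add[OF that, of n "- m"] by (simp add: character_uminus[OF that])
  have "fourier (character n) m = (\<integral>l. character (n - m) l \<partial>haar)"
    unfolding fourier_def
    by (intro Bochner_Integration.integral_cong)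
       (auto simp: sp diff)
  also have "\<dots> = (if n = m then 1 else 0)"
    using integral_character_haar[of "n - m"] prob_space by simp
  finally show ?thesis .
qed

text \<open>By orthogonality the only nonzero Fourier coefficient of \<open>character n\<close> is the one at \<open>n\<close>.\<close>

lemma character_in_A_tau: "tau n \<ge> 0 \<Longrightarrow> character n \<in> A_tau_torus"
  by (auto simp: A_tau_torus_def continuous_on_character fourier_character)

section \<open>The prime flow\<close>

lemma prime_nth_prime: "prime (nth_prime k)"
  using enumerate_in_set[OF primes_infinite, of k] by (simp add: nth_prime_def)

lemma nth_prime_surj: "prime p \<Longrightarrow> \<exists>k. nth_prime k = p"
  using enumerate_Ex[OF primes_infinite, of p] by (simp add: nth_prime_def)

lemma prime_flow_cis: "prime_flow s k = cis (- s * ln (nth_prime k))"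
proof -
  have "nth_prime k > 0" using prime_gt_0_nat[OF prime_nth_prime] .
  then show ?thesis
    by (simp add: prime_flow_def powr_def cis_conv_exp mult_ac)
qed

lemma prime_flow_in_torus: "prime_flow s \<in> torus"
  by (simp add: torus_def prime_flow_cis)

lemma prime_flow_diff: "prime_flow s k * inverse (prime_flow u k) = prime_flow (s - u) k"
  by (simp add: prime_flow_cis cis_mult algebra_simps)

lemma character_prime_flow: "character n (prime_flow s) = cis (- s * tau n)"
proof -
  have prod_cis: "(\<Prod>k\<in>K. cis (a k)) = cis (\<Sum>k\<in>K. a k)" if "finite K" for K and a :: "nat \<Rightarrow> real"
    using that by (induction K) (auto simp: cis_mult)
  have "character n (prime_flow s) =
      (\<Prod>k\<in>Poly_Mapping.keys n. cis (of_int (Poly_Mapping.lookup n k) * (- s * ln (nth_prime k))))"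
    by (simp only: character_def prime_flow_cis cis_power_int)
  also have "\<dots> = cis (- s * tau n)"
    by (subst prod_cis) (auto simp: tau_def sum_distrib_left sum_negf mult_ac)
  finally show ?thesis .
qed

lemma continuous_on_prime_flow: "continuous_on UNIV prime_flow"
  unfolding prime_flow_cis[abs_def] by (intro continuous_intros)

lemma prime_flow_measurable: "prime_flow \<in> measurable borel torus_borel"
  by (intro measurable_torus_borelI borel_measurable_continuous_onI continuous_on_prime_flow prime_flow_in_torus)

lemma continuous_on_compose_prime_flow:
  "continuous_on torus f \<Longrightarrow> continuous_on UNIV (\<lambda>s. f (prime_flow s))"
  by (rule continuous_on_compose2[OF _ continuous_on_prime_flow]) (auto simp: prime_flow_in_torus)

section \<open>The Cauchy distribution\<close>

definition cauchy_density :: "real \<Rightarrow> real \<Rightarrow> real \<Rightarrow> real" where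
  "cauchy_density \<sigma> t s = \<sigma> / (pi * (\<sigma>\<^sup>2 + (s - t)\<^sup>2))"

definition cauchy_distribution :: "real \<Rightarrow> real \<Rightarrow> real measure" where
  "cauchy_distribution \<sigma> t = density lborel (\<lambda>s. ennreal (cauchy_density \<sigma> t s))"

lemma cauchy_density_nonneg: "\<sigma> > 0 \<Longrightarrow> cauchy_density \<sigma> t s \<ge> 0"
  by (simp add: cauchy_density_def)

lemma borel_measurable_cauchy_density [measurable]: "cauchy_density \<sigma> t \<in> borel_measurable borel"
  unfolding cauchy_density_def[abs_def] by measurable

lemma sets_cauchy_distribution [simp, measurable_cong]: "sets (cauchy_distribution \<sigma> t) = sets borel"
  by (simp add: cauchy_distribution_def)

lemma cauchy_density_affine:
  assumes "\<sigma> > 0"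
  shows "\<sigma> * cauchy_density \<sigma> t (t + \<sigma> * s) = 1 / (1 + s\<^sup>2) / pi"
proof -
  have "cauchy_density \<sigma> t (t + \<sigma> * s) = \<sigma> / (pi * (\<sigma>\<^sup>2 * (1 + s\<^sup>2)))"
    by (simp add: cauchy_density_def algebra_simps power_mult_distrib)
  also have "\<sigma> * \<dots> = \<sigma>\<^sup>2 / (\<sigma>\<^sup>2 * (pi * (1 + s\<^sup>2)))" by (simp add: power2_eq_square mult_ac)
  also have "\<dots> = 1 / (1 + s\<^sup>2) / pi" using assms by simp
  finally show ?thesis .
qed

text \<open>The Cauchy distribution is the image of the standard one under \<open>s \<mapsto> t + \<sigma> * s\<close>. All
  integrals against it are reduced to the standard case in this form, in which change of scale,
  translation and reflection are visible. It holds for every measurable \<open>f\<close>, with both sides 0 if \<open>f\<close>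
  is not integrable.\<close>

lemma integral_cauchy_distribution:
  fixes f :: "real \<Rightarrow> 'a::{banach, second_countable_topology}"
  assumes "\<sigma> > 0" and [measurable]: "f \<in> borel_measurable borel"
  shows "(\<integral>s. f s \<partial>cauchy_distribution \<sigma> t) = (\<integral>s. (1 / (1 + s\<^sup>2) / pi) *\<^sub>R f (t + \<sigma> * s) \<partial>lborel)"
proof -
  have "(\<integral>s. f s \<partial>cauchy_distribution \<sigma> t) = (\<integral>s. cauchy_density \<sigma> t s *\<^sub>R f s \<partial>lborel)"
    unfolding cauchy_distribution_def using assms(1)
    by (subst integral_density) (auto simp: cauchy_density_nonneg)
  also have "\<dots> = \<bar>\<sigma>\<bar> *\<^sub>R (\<integral>s. cauchy_density \<sigma> t (t + \<sigma> * s) *\<^sub>R f (t + \<sigma> * s) \<partial>lborel)"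
    using assms(1) by (subst lborel_integral_real_affine[of \<sigma> _ t]) auto
  also have "\<dots> = (\<integral>s. (\<sigma> * cauchy_density \<sigma> t (t + \<sigma> * s)) *\<^sub>R f (t + \<sigma> * s) \<partial>lborel)"
    using assms(1) by (simp flip: integral_scaleR_right)
  finally show ?thesis by (simp only: cauchy_density_affine[OF assms(1)])
qed

lemma prob_space_cauchy_distribution:
  assumes "\<sigma> > 0"
  shows "prob_space (cauchy_distribution \<sigma> t)"
proof
  \<comment> \<open>The density in terms of the standard one, for integrability by affine substitution.\<close>
  have aff: "cauchy_density \<sigma> t s = 1 / (1 + ((- t / \<sigma>) + (1 / \<sigma>) * s)\<^sup>2) / pi / \<sigma>" for s
  proof -
    have "t + \<sigma> * ((- t / \<sigma>) + (1 / \<sigma>) * s) = s" using assms by (simp add: field_simps)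
    then show ?thesis
      using cauchy_density_affine[OF assms, of t "(- t / \<sigma>) + (1 / \<sigma>) * s"] assms
      by (metis less_irrefl nonzero_mult_div_cancel_left)
  qed
  have int: "integrable lborel (cauchy_density \<sigma> t)"
    unfolding aff[abs_def] using assms
    by (intro integrable_divide lborel_integrable_real_affine[OF integrable_inverse_1_plus_square_lborel]) auto
  have "integral\<^sup>L lborel (cauchy_density \<sigma> t) = (\<integral>s. (1::real) \<partial>cauchy_distribution \<sigma> t)"
    unfolding cauchy_distribution_def using assms
    by (subst integral_density) (auto simp: cauchy_density_nonneg)
  also have "\<dots> = (\<integral>s. 1 / (1 + s\<^sup>2) / pi \<partial>lborel)"
    by (subst integral_cauchy_distribution) (auto simp: assms)
  also have "\<dots> = 1"
    by (simp only: integral_divide_zero integral_inverse_1_plus_square_lborel) simp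
  finally have "integral\<^sup>L lborel (cauchy_density \<sigma> t) = 1" .
  then show "emeasure (cauchy_distribution \<sigma> t) (space (cauchy_distribution \<sigma> t)) = 1"
    using nn_integral_eq_integral[OF int] assms
    by (simp add: cauchy_distribution_def emeasure_density cauchy_density_nonneg)
qed

lemma char_cauchy_distribution:
  assumes "\<sigma> > 0"
  shows "char (cauchy_distribution \<sigma> t) x = iexp (x * t) * exp (- \<sigma> * \<bar>x\<bar>)"
proof -
  have "char (cauchy_distribution \<sigma> t) x =
      (\<integral>s. (1 / (1 + s\<^sup>2) / pi) *\<^sub>R iexp (x * (t + \<sigma> * s)) \<partial>lborel)"
    unfolding char_def using assms by (rule integral_cauchy_distribution) measurable
  also have "\<dots> = (\<integral>s. (iexp (x * t) / pi) * (iexp ((x * \<sigma>) * s) / (1 + s\<^sup>2)) \<partial>lborel)"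
    by (intro Bochner_Integration.integral_cong)
       (auto simp: scaleR_conv_of_real exp_add[symmetric] algebra_simps)
  also have "\<dots> = (iexp (x * t) / pi) * (pi * exp (- \<bar>x * \<sigma>\<bar>))"
    by (subst integral_mult_right_zero) (simp only: integral_iexp_over_1_plus_square)
  finally show ?thesis using assms by (simp add: abs_mult mult.commute)
qed

section \<open>Poisson measures as images of Cauchy distributions\<close>

text \<open>Along the flow a conjugated character is \<open>iexp (tau n * s)\<close>. The Fourier coefficients of the image
  measure are therefore values of the Cauchy characteristic function.\<close>

lemma poisson_eq_flow_of_cauchy:
  assumes "\<sigma> > 0"
  shows "poisson \<sigma> = distr (cauchy_distribution \<sigma> 0) torus_borel prime_flow"
proof (rule poisson_eqI)
  interpret prob_space "cauchy_distribution \<sigma> 0" by (rule prob_space_cauchy_distribution[OF assms])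
  have m: "prime_flow \<in> measurable (cauchy_distribution \<sigma> 0) torus_borel"
    using prime_flow_measurable by simp
  show "finite_measure (distr (cauchy_distribution \<sigma> 0) torus_borel prime_flow)"
    using m by (rule finite_measure_distr)
  show "fourier_measure (distr (cauchy_distribution \<sigma> 0) torus_borel prime_flow) n =
      of_real (exp (- \<sigma> * \<bar>tau n\<bar>))" for n
  proof -
    have flow: "cnj (character n (prime_flow s)) = iexp (tau n * s)" for s
    proof -
      have "cnj (character n (prime_flow s)) = cis (tau n * s)"
        by (simp add: character_prime_flow cis_cnj mult.commute)
      then show ?thesis by (simp only: cis_conv_exp)
    qed
    have "fourier_measure (distr (cauchy_distribution \<sigma> 0) torus_borel prime_flow) n =
        (\<integral>s. cnj (character n (prime_flow s)) \<partial>cauchy_distribution \<sigma> 0)"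
      unfolding fourier_measure_def
      by (intro integral_distr[OF m] borel_measurable_torus_borel continuous_on_cnj continuous_on_character)
    also have "\<dots> = char (cauchy_distribution \<sigma> 0) (tau n)"
      by (simp only: char_def flow)
    finally show ?thesis by (simp add: char_cauchy_distribution[OF assms])
  qed
qed simp

lemma poisson_0_eq: "poisson 0 = return torus_borel (\<lambda>_. 1)"
proof (rule poisson_eqI)
  have 1: "(\<lambda>_. 1) \<in> torus" by (simp add: torus_def)
  show "finite_measure (return torus_borel (\<lambda>_. 1))"
    using 1 by (intro prob_space.finite_measure prob_space_return) simp
  show "fourier_measure (return torus_borel (\<lambda>_. 1)) n = of_real (exp (- 0 * \<bar>tau n\<bar>))" for n
  proof -
    have "character n (\<lambda>_. 1) = 1" by (simp add: character_def)
    then show ?thesis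
      unfolding fourier_measure_def using 1
      by (subst integral_return)
         (auto intro!: borel_measurable_torus_borel continuous_on_cnj continuous_on_character)
  qed
qed simp

lemma continuous_on_torus_translate:
  assumes "continuous_on torus f" "l \<in> torus"
  shows "continuous_on torus (\<lambda>b. f (\<lambda>k. l k * inverse (b k)))"
proof (rule continuous_on_compose2[OF assms(1)])
  show "continuous_on torus (\<lambda>b k. l k * inverse (b k))"
    by (intro continuous_intros continuous_on_subset[OF continuous_on_product_coordinates])
       (auto simp: torus_nonzero)
qed (auto intro: torus_mult assms torus_inverse)

lemma poisson_conv_0:
  assumes "continuous_on torus f" "l \<in> torus"
  shows "poisson_conv f 0 l = f l"
  unfolding poisson_conv_def poisson_0_eq
  by (subst integral_return)
     (auto simp: torus_def intro!: borel_measurable_torus_borel continuous_on_torus_translate assms)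

text \<open>The flow is a homomorphism, so dividing \<open>prime_flow t\<close> by \<open>prime_flow s\<close> gives \<open>prime_flow (t - s)\<close>.
  The symmetry of the Cauchy density then turns convolution into integration against the density
  centred at \<open>t\<close>.\<close>

lemma poisson_conv_prime_flow:
  assumes "\<sigma> > 0" "continuous_on torus f"
  shows "poisson_conv f \<sigma> (prime_flow t) = (\<integral>s. f (prime_flow s) \<partial>cauchy_distribution \<sigma> t)"
proof -
  define g where "g s = f (prime_flow s)" for s
  have [measurable]: "g \<in> borel_measurable borel"
    unfolding g_def[abs_def]
    by (intro borel_measurable_continuous_onI continuous_on_compose_prime_flow assms)
  have m: "prime_flow \<in> measurable (cauchy_distribution \<sigma> 0) torus_borel"
    using prime_flow_measurable by simp
  have "poisson_conv f \<sigma> (prime_flow t) = (\<integral>s. g (t - s) \<partial>cauchy_distribution \<sigma> 0)"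
    unfolding poisson_conv_def poisson_eq_flow_of_cauchy[OF assms(1)]
    by (subst integral_distr[OF m])
       (auto simp: prime_flow_diff g_def intro!: borel_measurable_torus_borel
          continuous_on_torus_translate assms prime_flow_in_torus)
  also have "\<dots> = (\<integral>s. (1 / (1 + s\<^sup>2) / pi) *\<^sub>R g (t - \<sigma> * s) \<partial>lborel)"
    using assms(1) by (subst integral_cauchy_distribution) auto
  also have "\<dots> = (\<integral>s. (1 / (1 + s\<^sup>2) / pi) *\<^sub>R g (t + \<sigma> * s) \<partial>lborel)"
    by (subst lborel_integral_real_affine[of "-1" _ 0]) auto
  also have "\<dots> = (\<integral>s. g s \<partial>cauchy_distribution \<sigma> t)"
    using assms(1) by (subst integral_cauchy_distribution) auto
  finally show ?thesis by (simp add: g_def)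
qed

section \<open>Density of the frequencies\<close>

text \<open>The range of \<^const>\<open>tau\<close> is closed under addition and contains the logarithms of the primes.\<close>

lemma ln_nat_in_range_tau: "a > 0 \<Longrightarrow> ln (real a) \<in> range tau"
proof (induction a rule: less_induct)
  case (less a)
  show ?case
  proof (cases "a = 1")
    case True
    then show ?thesis using tau_zero by (metis ln_one of_nat_1 rangeI)
  next
    case False
    then obtain p where p: "prime p" "p dvd a" using prime_factor_nat by blast
    then obtain b where b: "a = p * b" by auto
    obtain k where k: "nth_prime k = p" using nth_prime_surj p by blast
    have "b > 0" using less.prems b by (cases b) auto
    moreover have "b < a" using b \<open>b > 0\<close> prime_gt_1_nat[OF p(1)] by simp
    ultimately obtain n where n: "ln (real b) = tau n" using less.IH by blast
    have "tau (Poly_Mapping.single k 1) = ln (real p)"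
      by (simp add: tau_def k)
    then have "tau (Poly_Mapping.single k 1 + n) = ln (real p) + ln (real b)" by (simp add: tau_add n)
    also have "\<dots> = ln (real a)"
      using \<open>b > 0\<close> prime_gt_0_nat[OF p(1)] by (simp add: b ln_mult)
    finally show ?thesis by (metis rangeI)
  qed
qed

text \<open>Being a group, the range of \<^const>\<open>tau\<close> contains the logarithms of all positive rationals.\<close>

lemma range_tau_dense: "closure (range tau) = UNIV"
proof -
  have "\<exists>n. x < tau n \<and> tau n < y" if "x < y" for x y
  proof -
    have "exp x < exp y" using that by simp
    from of_rat_dense[OF this] obtain q :: rat where q: "exp x < of_rat q" "of_rat q < exp y"
      by blast
    then have "q > 0" by (metis exp_gt_zero less_trans zero_less_of_rat_iff)
    obtain a b where ab: "quotient_of q = (a, b)" by fastforce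
    then have b: "b > 0" and qab: "q = of_int a / of_int b"
      using quotient_of_denom_pos quotient_of_div by auto
    then have a: "a > 0" using \<open>q > 0\<close> by (simp add: zero_less_divide_iff)
    obtain m n where "ln (real (nat a)) = tau m" "ln (real (nat b)) = tau n"
      using ln_nat_in_range_tau[of "nat a"] ln_nat_in_range_tau[of "nat b"] a b by auto
    then have "tau (m + - n) = ln (of_int a) - ln (of_int b)"
      using a b by (simp only: tau_add tau_uminus) simp
    also have "\<dots> = ln (of_rat q)" using a b by (simp add: qab of_rat_divide ln_div)
    finally have "exp (tau (m + - n)) = of_rat q" using \<open>q > 0\<close> by simp
    then show ?thesis using q by (metis exp_less_cancel_iff)
  qed
  then show ?thesis
    by (auto simp: closure_approachable dist_real_def)
       (metis abs_of_pos diff_gt_0_iff_gt less_add_same_cancel1 diff_less_eq add.commute)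
qed


section \<open>Representing measures on the imaginary axis\<close>

lemma half_plane_fun_imag_axis:
  assumes "f \<in> A_tau_torus" "Re z = 0"
  shows "half_plane_fun f (Some z) = f (prime_flow (Im z))"
  using assms by (simp add: half_plane_fun_def Hbar_def A_tau_torus_def poisson_conv_0 prime_flow_in_torus)

lemma half_plane_fun_interior:
  assumes "f \<in> A_tau_torus" "\<sigma> > 0"
  shows "half_plane_fun f (Some (Complex \<sigma> t)) = (\<integral>s. f (prime_flow s) \<partial>cauchy_distribution \<sigma> t)"
  using assms by (simp add: half_plane_fun_def Hbar_def A_tau_torus_def poisson_conv_prime_flow)

lemma space_imag_borel [simp]: "space imag_borel = imag_axis"
  by (simp add: imag_borel_def space_restrict_space)

lemma imag_embedding_measurable [measurable]: "(\<lambda>s. \<i> * of_real s) \<in> measurable borel imag_borel"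
  unfolding imag_borel_def by (intro measurable_restrict_space2) (auto simp: imag_axis_def)

lemma Im_measurable_imag_borel [measurable]: "Im \<in> borel_measurable imag_borel"
  unfolding imag_borel_def by (intro measurable_restrict_space1) measurable

lemma poisson_kernel_eq_image_of_cauchy:
  "density imag_lebesgue (\<lambda>z. ennreal (cauchy_density \<sigma> t (Im z))) =
     distr (cauchy_distribution \<sigma> t) imag_borel (\<lambda>s. \<i> * of_real s)"
proof -
  have 1: "(\<lambda>z. ennreal (cauchy_density \<sigma> t (Im z))) \<in> borel_measurable imag_borel" by measurable
  have 2: "(\<lambda>s. \<i> * of_real s) \<in> measurable lborel imag_borel" by simp
  show ?thesis
    unfolding imag_lebesgue_def cauchy_distribution_def density_distr[OF 1 2] by simp
qed

text \<open>Under the parametrisation \<open>s \<mapsto> \<i> * s\<close> of the axis, the integral of a boundary function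
  against the kernel is the integral of \<open>f\<close> along the flow against the Cauchy distribution, which is
  the value at the interior point.\<close>

lemma poisson_kernel_represents:
  assumes "\<sigma> > 0"
  shows "ac_representing_measure (Some (Complex \<sigma> t))
    (density imag_lebesgue (\<lambda>z. ennreal (cauchy_density \<sigma> t (Im z))))"
proof -
  interpret prob_space "cauchy_distribution \<sigma> t" by (rule prob_space_cauchy_distribution[OF assms])
  have m: "(\<lambda>s. \<i> * of_real s) \<in> measurable (cauchy_distribution \<sigma> t) imag_borel" by simp
  have "integrable (density imag_lebesgue (\<lambda>z. ennreal (cauchy_density \<sigma> t (Im z)))) (\<lambda>z. F (Some z)) \<and>
      F (Some (Complex \<sigma> t)) = (\<integral>z. F (Some z) \<partial>density imag_lebesgue (\<lambda>z. ennreal (cauchy_density \<sigma> t (Im z))))"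
    if "F \<in> A_tau_Hbar" for F
  proof -
    from that obtain f where f: "f \<in> A_tau_torus" "F = half_plane_fun f" by (auto simp: A_tau_Hbar_def)
    then have cont: "continuous_on torus f" by (simp add: A_tau_torus_def)
    have [measurable]: "(\<lambda>s. f (prime_flow s)) \<in> borel_measurable borel"
      by (intro borel_measurable_continuous_onI continuous_on_compose_prime_flow cont)
    have "(\<lambda>z. f (prime_flow (Im z))) \<in> borel_measurable imag_borel"
      by (rule measurable_compose[OF Im_measurable_imag_borel]) measurable
    then have F: "(\<lambda>z. F (Some z)) \<in> borel_measurable imag_borel"
      by (subst measurable_cong[where g = "\<lambda>z. f (prime_flow (Im z))"])
         (auto simp: f half_plane_fun_imag_axis imag_axis_def)
    have eq: "F (Some (\<i> * of_real s)) = f (prime_flow s)" for s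
      by (simp add: f half_plane_fun_imag_axis)
    obtain B where B: "\<And>l. l \<in> torus \<Longrightarrow> norm (f l) \<le> B"
      using bounded_continuous_torus[OF cont] by blast
    have "integrable (cauchy_distribution \<sigma> t) (\<lambda>s. f (prime_flow s))"
      using B prime_flow_in_torus by (intro integrable_const_bound[of _ B]) auto
    moreover have "F (Some (Complex \<sigma> t)) = (\<integral>s. f (prime_flow s) \<partial>cauchy_distribution \<sigma> t)"
      using f half_plane_fun_interior assms by simp
    ultimately show ?thesis
      unfolding poisson_kernel_eq_image_of_cauchy integrable_distr_eq[OF m F] integral_distr[OF m F] eq
      by blast
  qed
  then show ?thesis
    by (auto simp: ac_representing_measure_def represents_def imag_lebesgue_def intro!: absolutely_continuousI_density)
qed

text \<open>Testing against characters with \<open>tau n \<ge> 0\<close> gives the characteristic function of the measure on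
  the nonpositive elements of a dense set. The measure is positive, so conjugation gives it on the
  remaining ones.\<close>

lemma representing_measure_unique:
  assumes \<sigma>: "\<sigma> > 0"
    and \<mu>: "sets \<mu> = sets imag_borel" "represents \<mu> (Some (Complex \<sigma> t))"
    and \<nu>: "sets \<nu> = sets imag_borel" "represents \<nu> (Some (Complex \<sigma> t))"
  shows "\<mu> = \<nu>"
proof -
  define w where "w = Some (Complex \<sigma> t)"
  have rep_w: "represents \<mu> w" "represents \<nu> w"
    using \<mu>(2) \<nu>(2) by (simp_all only: w_def)
  define L where "L \<kappa> = distr \<kappa> borel Im" for \<kappa> :: "complex measure"
  have Im_meas: "Im \<in> borel_measurable \<kappa>" if "sets \<kappa> = sets imag_borel" for \<kappa>
    using Im_measurable_imag_borel measurable_cong_sets[OF that refl] by blast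
  have sp: "space \<kappa> = imag_axis" if "sets \<kappa> = sets imag_borel" for \<kappa>
    using sets_eq_imp_space_eq[OF that] by simp
  have rep: "integrable \<kappa> (\<lambda>z. cis (- Im z * tau n))" 
      "(\<integral>z. cis (- Im z * tau n) \<partial>\<kappa>) = half_plane_fun (character n) w"
    if \<kappa>: "sets \<kappa> = sets imag_borel" "represents \<kappa> w" and n: "tau n \<ge> 0" for \<kappa> n
  proof -
    have mem: "half_plane_fun (character n) \<in> A_tau_Hbar"
      using character_in_A_tau[OF n] by (simp add: A_tau_Hbar_def)
    have eq: "half_plane_fun (character n) (Some z) = cis (- Im z * tau n)" if "z \<in> space \<kappa>" for z
      using that sp[OF \<kappa>(1)] character_in_A_tau[OF n]
      by (simp add: half_plane_fun_imag_axis character_prime_flow imag_axis_def)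
    have "integrable \<kappa> (\<lambda>z. half_plane_fun (character n) (Some z)) \<longleftrightarrow>
        integrable \<kappa> (\<lambda>z. cis (- Im z * tau n))"
      by (rule Bochner_Integration.integrable_cong[OF refl eq])
    then show "integrable \<kappa> (\<lambda>z. cis (- Im z * tau n))"
      using \<kappa>(2) mem by (simp only: represents_def)
    have "(\<integral>z. half_plane_fun (character n) (Some z) \<partial>\<kappa>) = (\<integral>z. cis (- Im z * tau n) \<partial>\<kappa>)"
      by (rule Bochner_Integration.integral_cong[OF refl eq])
    then show "(\<integral>z. cis (- Im z * tau n) \<partial>\<kappa>) = half_plane_fun (character n) w"
      using \<kappa>(2) mem by (metis represents_def)
  qed
  \<comment> \<open>The constant 1 belongs to the algebra, so representing measures are probability measures.\<close>
  have total: "half_plane_fun (character 0) w = 1"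
  proof -
    interpret prob_space "cauchy_distribution \<sigma> t" by (rule prob_space_cauchy_distribution[OF \<sigma>])
    show ?thesis using character_in_A_tau[of 0] prob_space
      by (simp add: w_def half_plane_fun_interior \<sigma>)
  qed
  have dist: "real_distribution (L \<kappa>)" if \<kappa>: "sets \<kappa> = sets imag_borel" "represents \<kappa> w" for \<kappa>
  proof -
    have i: "integrable \<kappa> (\<lambda>z. 1 :: complex)" "(\<integral>z. 1 \<partial>\<kappa>) = (1 :: complex)"
      using rep[OF \<kappa>, of 0] total by simp_all
    then have "emeasure \<kappa> (space \<kappa>) \<noteq> \<infinity>" by (simp add: integrable_iff_bounded)
    then interpret finite_measure \<kappa> by (rule finite_measureI)
    have "measure \<kappa> (space \<kappa>) = 1" using i(2) by (simp add: scaleR_conv_of_real)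
    then have "prob_space \<kappa>" by (intro prob_spaceI) (simp add: emeasure_eq_measure)
    then interpret P: prob_space \<kappa> .
    have "prob_space (L \<kappa>)" unfolding L_def by (rule P.prob_space_distr[OF Im_meas[OF \<kappa>(1)]])
    then show ?thesis by (simp add: real_distribution_def real_distribution_axioms_def L_def)
  qed
  have char_L: "char (L \<kappa>) x = (\<integral>z. cis (Im z * x) \<partial>\<kappa>)" if "sets \<kappa> = sets imag_borel" for \<kappa> x
    unfolding char_def L_def by (subst integral_distr[OF Im_meas[OF that]]) (auto simp: cis_conv_exp mult.commute)
  have char_tau: "char (L \<kappa>) (tau n) =
      (if tau n \<le> 0 then half_plane_fun (character (- n)) w else cnj (half_plane_fun (character n) w))"
    if \<kappa>: "sets \<kappa> = sets imag_borel" "represents \<kappa> w" for \<kappa> n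
  proof (cases "tau n \<le> 0")
    case True
    then show ?thesis using rep(2)[OF \<kappa>, of "- n"] by (simp add: char_L[OF \<kappa>(1)] tau_uminus)
  next
    case False
    have "char (L \<kappa>) (tau n) = (\<integral>z. cnj (cis (- Im z * tau n)) \<partial>\<kappa>)"
      by (simp add: char_L[OF \<kappa>(1)] cis_cnj)
    also have "\<dots> = cnj (half_plane_fun (character n) w)"
      using False by (simp only: Bochner_Integration.integral_cnj rep(2)[OF \<kappa>] linorder_not_le less_imp_le)
    finally show ?thesis using False by simp
  qed
  have "char (L \<mu>) = char (L \<nu>)"
  proof
    fix x
    interpret M: real_distribution "L \<mu>" by (rule dist[OF \<mu>(1) rep_w(1)])
    interpret N: real_distribution "L \<nu>" by (rule dist[OF \<nu>(1) rep_w(2)])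
    have cont: "continuous_on UNIV (char (L \<mu>))" "continuous_on UNIV (char (L \<nu>))"
      using M.isCont_char N.isCont_char by (auto intro: continuous_at_imp_continuous_on)
    have "closed {x. char (L \<mu>) x = char (L \<nu>) x}"
      using closed_Collect_eq[OF cont] .
    moreover have "char (L \<mu>) (tau n) = char (L \<nu>) (tau n)" for n
      by (simp only: char_tau[OF \<mu>(1) rep_w(1)] char_tau[OF \<nu>(1) rep_w(2)])
    then have "range tau \<subseteq> {x. char (L \<mu>) x = char (L \<nu>) x}"
      by blast
    ultimately have "closure (range tau) \<subseteq> {x. char (L \<mu>) x = char (L \<nu>) x}"
      by (rule closure_minimal[rotated])
    then show "char (L \<mu>) x = char (L \<nu>) x" unfolding range_tau_dense by blast
  qed
  then have L_eq: "L \<mu> = L \<nu>"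
    by (rule Levy_uniqueness[OF dist[OF \<mu>(1) rep_w(1)] dist[OF \<nu>(1) rep_w(2)]])
  have recover: "distr (L \<kappa>) imag_borel (\<lambda>s. \<i> * of_real s) = \<kappa>" if \<kappa>: "sets \<kappa> = sets imag_borel" for \<kappa>
  proof -
    have "distr (L \<kappa>) imag_borel (\<lambda>s. \<i> * of_real s) = distr \<kappa> imag_borel (\<lambda>z. \<i> * of_real (Im z))"
      unfolding L_def by (subst distr_distr[OF _ Im_meas[OF \<kappa>]]) (auto simp: comp_def)
    also have "\<dots> = distr \<kappa> \<kappa> (\<lambda>z. z)"
      using \<kappa> by (intro distr_cong) (auto simp: sp[OF \<kappa>] imag_axis_def complex_eq_iff)
    finally show ?thesis by (simp add: distr_id)
  qed
  show ?thesis using recover[OF \<mu>(1)] recover[OF \<nu>(1)] unfolding L_eq by (rule trans[OF sym])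
qed

theorem theorem7p1:
  fixes \<sigma> t :: real
  assumes "\<sigma> > 0"
  shows "(\<exists>!\<mu>. ac_representing_measure (Some (Complex \<sigma> t)) \<mu>) \<and>
    ac_representing_measure (Some (Complex \<sigma> t))
      (density imag_lebesgue (\<lambda>z. ennreal (\<sigma> / (pi * (\<sigma>\<^sup>2 + (Im z - t)\<^sup>2)))))"
proof -
  let ?P = "density imag_lebesgue (\<lambda>z. ennreal (\<sigma> / (pi * (\<sigma>\<^sup>2 + (Im z - t)\<^sup>2))))"
  have P: "ac_representing_measure (Some (Complex \<sigma> t)) ?P"
    using poisson_kernel_represents[OF assms, of t] by (simp only: cauchy_density_def)
  moreover have "\<mu> = ?P" if "ac_representing_measure (Some (Complex \<sigma> t)) \<mu>" for \<mu>
    using that P by (intro representing_measure_unique[OF assms, of \<mu> t]) (simp_all only: ac_representing_measure_def)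
  ultimately show ?thesis by blast
qed

end
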